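(* Let $\omega:\{1,2,\dots,n\}\to\mathbb{N}$ be a function. There is a one-to-one correspondence between the acyclic $\omega$-vector weighted digraphs with labeled vertices $v_1,\dots,v_n$ and $M_\omega(n)$. In particular, $$|M_\omega(n)|=\sum_{G\in\mathcal{G}_n}\ \prod_{v_i\in V(G)}(2^{\omega(i)}-1)^{\mathrm{outdeg}(v_i)},$$ where $\mathcal{G}_n$ is the set of acyclic digraphs with $n$ labeled vertices $v_1,\dots,v_n$ and $\mathrm{outdeg}(v_i)$ is the number of edges directed from $v_i$.
   Context: $\mathbb{N}$ denotes the positive integers. A digraph with labeled vertices $\{v_1,\dots,v_n\}$ is $\omega$-vector weighted if every edge $(v_i,v_j)$ (if it exists) is assigned a non-zero vector in $\mathbb{Z}_2^{\omega(i)}$. It is acyclic if it contains no directed cycle. Labeled digraphs are considered on the fixed vertex set and not up to isomorphism. $M_\omega(n)$ is the set of all $n\times n$ arrays $A=[\mathbf{v}_{ij}]$ (vector matrices of size $n$ over $\mathbb{Z}_2$) whose entries in the $i$-th row are vectors $\mathbf{v}_{ij}\in\mathbb{Z}_2^{\omega(i)}$ and which satisfy: for all choices $1\le k_i\le\omega(i)$, $1\le i\le n$, every principal minor of the $n\times n$ matrix $A_{k_1\cdots k_n}$ over $\mathbb{Z}_2$, whose $(i,j)$-th entry is the $k_i$-th coordinate $(\mathbf{v}_{ij})_{k_i}$ of $\mathbf{v}_{ij}$, equals $1$. *)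

theory Defs
  imports
    "HOL-Library.Z2"
    "HOL-Library.FuncSet"
    "Graph_Theory.Pair_Digraph"
    "Jordan_Normal_Form.Determinant"
    "Jordan_Normal_Form.DL_Submatrix"
begin

text \<open>
  Vertices, matrix indices and vector coordinates are numbered from 0: the vertex
  \<open>v\<^sub>i\<close> of the mathematical text is the number \<open>i - 1\<close>, the vertex set is \<open>{..<n}\<close>, and
  \<open>\<omega>\<close> matters only on \<open>{..<n}\<close>. The field with two elements is the type \<open>bit\<close>, and
  \<open>\<int>\<^sub>2\<^sup>m\<close> is \<open>carrier_vec m\<close> at type \<open>bit vec\<close>.
\<close>

text \<open>
  A directed cycle in the sense of \<open>pre_digraph.cycle\<close> is non-empty but may have length
  one or two, so acyclicity excludes loops and pairs of opposite edges.
\<close>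

definition acyclic_digraph :: "'a pair_pre_digraph \<Rightarrow> bool" where
  "acyclic_digraph G \<longleftrightarrow>
     pair_fin_digraph G \<and> \<not> (\<exists>p. pre_digraph.cycle (with_proj G) p)"

definition acyclic_digraphs :: "nat \<Rightarrow> nat pair_pre_digraph set" where
  "acyclic_digraphs n = {G. pverts G = {..<n} \<and> acyclic_digraph G}"

text \<open>
  A weighting is a function on the edge set; taking it extensional (\<open>PiE\<close>) makes equality
  of weighted digraphs depend on the weights of actual edges only.
\<close>

definition vector_weightings ::
    "(nat \<Rightarrow> nat) \<Rightarrow> nat pair_pre_digraph \<Rightarrow> (nat \<times> nat \<Rightarrow> bit vec) set" where
  "vector_weightings \<omega> G =
     (\<Pi>\<^sub>E e\<in>parcs G. carrier_vec (\<omega> (fst e)) - {0\<^sub>v (\<omega> (fst e))})"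

definition acyclic_weighted_digraphs ::
    "(nat \<Rightarrow> nat) \<Rightarrow> nat \<Rightarrow> (nat pair_pre_digraph \<times> (nat \<times> nat \<Rightarrow> bit vec)) set" where
  "acyclic_weighted_digraphs \<omega> n =
     {(G, w). G \<in> acyclic_digraphs n \<and> w \<in> vector_weightings \<omega> G}"

definition principal_minors :: "'a :: comm_ring_1 mat \<Rightarrow> 'a set" where
  "principal_minors B =
     {det (submatrix B I I) | I. I \<subseteq> {..<dim_row B} \<and> I \<noteq> {}}"

definition coordinate_matrix :: "nat \<Rightarrow> bit vec mat \<Rightarrow> (nat \<Rightarrow> nat) \<Rightarrow> bit mat" where
  "coordinate_matrix n A k = mat n n (\<lambda>(i, j). (A $$ (i, j)) $ k i)"

text \<open>
  The type constructor \<open>mat\<close> puts no algebraic constraint on the entries, so arrays of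
  vectors are matrices over \<open>bit vec\<close>.
\<close>

definition vector_matrices :: "(nat \<Rightarrow> nat) \<Rightarrow> nat \<Rightarrow> bit vec mat set" where
  "vector_matrices \<omega> n =
     {A \<in> carrier_mat n n.
        (\<forall>i<n. \<forall>j<n. A $$ (i, j) \<in> carrier_vec (\<omega> i)) \<and>
        (\<forall>k. (\<forall>i<n. k i < \<omega> i) \<longrightarrow>
             (\<forall>m\<in>principal_minors (coordinate_matrix n A k). m = 1))}"

end

theory Submission
  imports Defs
begin

text \<open>
  Over the field with two elements a vector is determined by its support, so every principal
  minor of \<open>B\<close> is 1 iff every non-empty index set \<open>S\<close> has a row \<open>i \<in> S\<close> whose entries in the
  columns \<open>S\<close> sum to 1. On the other side, a finite digraph is acyclic iff every non-empty vertex
  set has a sink. Join \<open>i\<close> to \<open>j \<noteq> i\<close> when the entry \<open>v\<^sub>i\<^sub>j\<close> of a vector matrix is non-zero. If all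
  \<open>v\<^sub>i\<^sub>i\<close> are all-ones vectors, a sink \<open>i\<close> of \<open>S\<close> gives a row with sum 1 in every coordinate matrix.
  Conversely, the sets \<open>{i}\<close> force the diagonal, and a minimal sinkless set \<open>I\<close> has exactly one arc
  inside \<open>I\<close> out of each vertex; choosing at each \<open>i \<in> I\<close> a coordinate where the vector on
  that arc is 1 makes all row sums over \<open>I\<close> equal to \<open>1 + 1 = 0\<close>.
\<close>

section \<open>Principal minors over the field with two elements\<close>

text \<open>\<open>pick I a\<close> is the element of \<open>I\<close> of rank \<open>a\<close>, so
  \<open>pick I\<close> is strictly increasing and hence injective; counting gives
  surjectivity.\<close>

lemma bij_betw_pick:
  assumes "finite I"
  shows "bij_betw (pick I) {..<card I} I"
proof -
  have inj: "inj_on (pick I) {..<card I}"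
    by (rule inj_onI) (metis lessThan_iff nat_neq_iff pick_mono_le)
  have "pick I ` {..<card I} \<subseteq> I"
    using pick_in_set_le by auto
  moreover have "card (pick I ` {..<card I}) = card I"
    using inj by (simp add: card_image)
  ultimately show ?thesis
    using inj assms by (simp add: bij_betw_def card_subset_eq)
qed

text \<open>A square matrix over an integral domain is singular iff it kills a non-zero vector.
  Reindexing along \<open>pick I\<close> replaces vectors of length \<open>card I\<close> by
  functions on the original indices.\<close>

lemma det_submatrix_eq_0_iff:
  fixes B :: "'a :: idom mat"
  assumes B: "B \<in> carrier_mat n n" and I: "I \<subseteq> {..<n}"
  shows "det (submatrix B I I) = 0 \<longleftrightarrow>
    (\<exists>x. (\<exists>j\<in>I. x j \<noteq> 0) \<and> (\<forall>i\<in>I. (\<Sum>j\<in>I. B $$ (i, j) * x j) = 0))"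
proof -
  define c where "c = card I"
  define p where "p = pick I"
  have "finite I" using I finite_subset by blast
  then have p: "bij_betw p {..<c} I"
    unfolding p_def c_def by (rule bij_betw_pick)
  have "{i. i < n \<and> i \<in> I} = I" using I by auto
  then have M: "submatrix B I I = mat c c (\<lambda>(a, b). B $$ (p a, p b))"
    using B by (simp add: submatrix_def c_def p_def)
  have sum_I: "(\<Sum>b<c. g (p b)) = (\<Sum>j\<in>I. g j)" for g :: "nat \<Rightarrow> 'a"
    by (rule sum.reindex_bij_betw[OF p])
  have all_I: "(\<forall>a<c. P (p a)) \<longleftrightarrow> (\<forall>i\<in>I. P i)" for P
    using p by (auto simp: bij_betw_def)
  have ex_I: "(\<exists>a<c. P (p a)) \<longleftrightarrow> (\<exists>i\<in>I. P i)" for P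
    using p by (auto simp: bij_betw_def)
  have mult: "submatrix B I I *\<^sub>v vec c (\<lambda>b. x (p b)) = 0\<^sub>v c \<longleftrightarrow>
      (\<forall>i\<in>I. (\<Sum>j\<in>I. B $$ (i, j) * x j) = 0)" for x
    unfolding all_I[symmetric] sum_I[symmetric] M
    by (auto simp: vec_eq_iff scalar_prod_def atLeast0LessThan)
  have nonzero: "vec c (\<lambda>b. x (p b)) \<noteq> 0\<^sub>v c \<longleftrightarrow> (\<exists>j\<in>I. x j \<noteq> 0)" for x :: "nat \<Rightarrow> 'a"
    unfolding ex_I[symmetric] by (auto simp: vec_eq_iff)
  \<comment> \<open>Every vector of length \<open>c\<close> comes from a function on indices:
    transport it back along the inverse of \<open>p\<close>.\<close>
  have vec: "\<exists>x. v = vec c (\<lambda>b. x (p b))" if "v \<in> carrier_vec c" for v :: "'a vec"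
    using that p
    by (intro exI[of _ "\<lambda>j. v $ inv_into {..<c} p j"])
       (auto simp: vec_eq_iff bij_betw_def)
  have "submatrix B I I \<in> carrier_mat c c" by (simp add: M)
  then have "det (submatrix B I I) = 0 \<longleftrightarrow>
      (\<exists>v. v \<in> carrier_vec c \<and> v \<noteq> 0\<^sub>v c \<and> submatrix B I I *\<^sub>v v = 0\<^sub>v c)"
    by (rule det_0_iff_vec_prod_zero)
  also have "\<dots> \<longleftrightarrow> (\<exists>x. vec c (\<lambda>b. x (p b)) \<noteq> 0\<^sub>v c \<and>
      submatrix B I I *\<^sub>v vec c (\<lambda>b. x (p b)) = 0\<^sub>v c)"
    using vec vec_carrier by metis
  finally show ?thesis
    unfolding mult nonzero .
qed

text \<open>A minor other than 1 is 0 and yields a kernel vector \<open>x\<close>. Pairing a row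
  with \<open>x\<close> sums that row over the support of \<open>x\<close>. Passing to the support
  changes the index set, so the equivalence is between statements about all index sets
  together.\<close>

lemma principal_minors_bit_eq_1_iff:
  fixes B :: "bit mat"
  assumes B: "B \<in> carrier_mat n n"
  shows "(\<forall>m\<in>principal_minors B. m = 1) \<longleftrightarrow>
    (\<forall>S\<subseteq>{..<n}. S \<noteq> {} \<longrightarrow> (\<exists>i\<in>S. (\<Sum>j\<in>S. B $$ (i, j)) = 1))"
proof -
  have minors: "(\<forall>m\<in>principal_minors B. m = 1) \<longleftrightarrow>
      (\<forall>I\<subseteq>{..<n}. I \<noteq> {} \<longrightarrow> det (submatrix B I I) \<noteq> 0)"
    using B by (auto simp: principal_minors_def)
  have support: "(\<Sum>j\<in>I. B $$ (i, j) * x j) = (\<Sum>j\<in>{j\<in>I. x j \<noteq> 0}. B $$ (i, j))"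
    if "finite I" for I i and x :: "nat \<Rightarrow> bit"
  proof -
    have "(\<Sum>j\<in>I. B $$ (i, j) * x j) = (\<Sum>j\<in>I. if x j \<noteq> 0 then B $$ (i, j) else 0)"
      by (rule sum.cong) (auto simp del: mult_bit_eq_and)
    then show ?thesis using that by (simp add: sum.inter_filter)
  qed
  show ?thesis
    unfolding minors
  proof (intro iffI allI impI)
    fix S assume *: "\<forall>I\<subseteq>{..<n}. I \<noteq> {} \<longrightarrow> det (submatrix B I I) \<noteq> 0"
      and S: "S \<subseteq> {..<n}" "S \<noteq> {}"
    show "\<exists>i\<in>S. (\<Sum>j\<in>S. B $$ (i, j)) = 1"
    proof (rule ccontr)
      assume "\<not> ?thesis"
      \<comment> \<open>In \<open>bit\<close> a row sum different from 1 is 0, so the constant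
        vector 1 lies in the kernel.\<close>
      then have "det (submatrix B S S) = 0"
        unfolding det_submatrix_eq_0_iff[OF B S(1)] using S(2)
        by (intro exI[of _ "\<lambda>_. 1"]) (auto simp del: mult_bit_eq_and)
      with * S show False by blast
    qed
  next
    fix I assume *: "\<forall>S\<subseteq>{..<n}. S \<noteq> {} \<longrightarrow> (\<exists>i\<in>S. (\<Sum>j\<in>S. B $$ (i, j)) = 1)"
      and I: "I \<subseteq> {..<n}" "I \<noteq> {}"
    have fin: "finite I" using I(1) finite_subset by blast
    show "det (submatrix B I I) \<noteq> 0"
    proof
      assume "det (submatrix B I I) = 0"
      then obtain x where x: "\<exists>j\<in>I. x j \<noteq> 0" "\<forall>i\<in>I. (\<Sum>j\<in>I. B $$ (i, j) * x j) = 0"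
        unfolding det_submatrix_eq_0_iff[OF B I(1)] by blast
      let ?S = "{j\<in>I. x j \<noteq> 0}"
      have "?S \<subseteq> {..<n}" "?S \<noteq> {}" using I(1) x(1) by blast+
      then obtain i where i: "i \<in> ?S" "(\<Sum>j\<in>?S. B $$ (i, j)) = 1"
        using *[rule_format, of ?S] by blast
      then have "(\<Sum>j\<in>?S. B $$ (i, j)) = 0"
        using x(2) support[OF fin, of i x] by simp
      with i(2) show False by simp
    qed
  qed
qed

section \<open>Acyclicity and sinks\<close>

text \<open>A closed non-empty walk contains a cycle, so acyclicity is that of the arc relation. For
  a finite relation this means that the converse is well-founded, and a minimal element for the
  converse is a sink.\<close>

lemma acyclic_digraph_iff_sinks:
  assumes "pair_fin_digraph G"
  shows "acyclic_digraph G \<longleftrightarrow>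
    (\<forall>S\<subseteq>pverts G. S \<noteq> {} \<longrightarrow> (\<exists>i\<in>S. \<forall>j\<in>S. (i, j) \<notin> parcs G))"
proof -
  interpret pair_fin_digraph G by fact
  have "(\<exists>p. cycle p) \<longleftrightarrow> (\<exists>u p. awalk u p u \<and> p \<noteq> [])"
    using closed_w_imp_cycle by (auto simp: closed_w_def cycle_def)
  also have "\<dots> \<longleftrightarrow> \<not> acyclic (parcs G)"
    by (auto simp: acyclic_def reachable1_awalk[symmetric])
  finally have "acyclic_digraph G \<longleftrightarrow> acyclic (parcs G)"
    using assms by (simp add: acyclic_digraph_def)
  also have "\<dots> \<longleftrightarrow> wf ((parcs G)\<inverse>)"
    using wf_iff_acyclic_if_finite[of "(parcs G)\<inverse>"] pair_finite_arcs by simp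
  also have "\<dots> \<longleftrightarrow> (\<forall>S. S \<noteq> {} \<longrightarrow> (\<exists>i\<in>S. \<forall>j\<in>S. (i, j) \<notin> parcs G))"
    by (simp add: wf_eq_minimal ex_in_conv[symmetric]) metis
  also have "\<dots> \<longleftrightarrow> (\<forall>S\<subseteq>pverts G. S \<noteq> {} \<longrightarrow> (\<exists>i\<in>S. \<forall>j\<in>S. (i, j) \<notin> parcs G))"
    (is "?L \<longleftrightarrow> ?R")
  proof (intro iffI allI impI)
    fix S :: "'a set" assume R: ?R and "S \<noteq> {}"
    show "\<exists>i\<in>S. \<forall>j\<in>S. (i, j) \<notin> parcs G"
    \<comment> \<open>Both ends of an arc are vertices: if \<open>S\<close> contains no vertex, each
      of its elements is a sink; otherwise a sink of \<open>S \<inter> pverts G\<close> is also one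
      of \<open>S\<close>.\<close>
    proof (cases "S \<inter> pverts G = {}")
      case True
      then show ?thesis using \<open>S \<noteq> {}\<close> in_arcsD1 by blast
    next
      case False
      then obtain i where "i \<in> S" "\<forall>j\<in>S \<inter> pverts G. (i, j) \<notin> parcs G"
        using R[rule_format, of "S \<inter> pverts G"] by auto
      then show ?thesis using in_arcsD2 by (intro bexI[of _ i]) auto
    qed
  qed blast
  finally show ?thesis .
qed

text \<open>Plays the role of the vertex set of a chordless cycle.\<close>

lemma sinkless_imp_unique_successors:
  assumes "finite S" "S \<noteq> {}" "\<And>i. i \<in> S \<Longrightarrow> \<exists>j\<in>S. R i j"
  shows "\<exists>I\<subseteq>S. I \<noteq> {} \<and> (\<forall>i\<in>I. \<exists>!j. j \<in> I \<and> R i j)"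
proof -
  define sinkless where "sinkless T \<longleftrightarrow> T \<noteq> {} \<and> (\<forall>i\<in>T. \<exists>j\<in>T. R i j)" for T
  have "sinkless S" using assms by (auto simp: sinkless_def)
  then have "{T. T \<subseteq> S \<and> sinkless T} \<noteq> {}" by blast
  moreover have "finite {T. T \<subseteq> S \<and> sinkless T}" using assms(1) by simp
  ultimately obtain I where "I \<in> {T. T \<subseteq> S \<and> sinkless T}"
      "\<forall>T\<in>{T. T \<subseteq> S \<and> sinkless T}. T \<subseteq> I \<longrightarrow> I = T"
    using finite_has_minimal by metis
  then have I: "I \<subseteq> S" "sinkless I"
      and minimal: "\<And>T. T \<subseteq> S \<Longrightarrow> sinkless T \<Longrightarrow> T \<subseteq> I \<Longrightarrow> T = I"
    by auto
  have fin: "finite I" using I(1) assms(1) finite_subset by blast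
  \<comment> \<open>The image of \<open>I\<close> under any choice \<open>f\<close> of successors is
    again sinkless, so minimality makes \<open>f\<close> onto \<open>I\<close>, and finiteness makes
    it injective.\<close>
  have inj: "inj_on f I" if f: "\<And>i. i \<in> I \<Longrightarrow> f i \<in> I \<and> R i (f i)" for f
  proof -
    have "sinkless (f ` I)"
      using I(2) f by (auto simp: sinkless_def)
    then have "f ` I = I" using minimal I(1) f by (metis image_subsetI subset_trans)
    then show ?thesis using fin by (simp add: eq_card_imp_inj_on)
  qed
  obtain f where f: "\<And>i. i \<in> I \<Longrightarrow> f i \<in> I \<and> R i (f i)"
    using I(2) unfolding sinkless_def by metis
  \<comment> \<open>Write a second successor \<open>j\<close> as \<open>f l\<close>. Redirecting
    \<open>f\<close> at \<open>i\<close> to \<open>j\<close> is again a choice of successors, hence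
    injective, yet it takes the value \<open>j\<close> at both \<open>l\<close> and
    \<open>i\<close>. So \<open>l = i\<close> and \<open>j = f i\<close>.\<close>
  have "j = f i" if i: "i \<in> I" and j: "j \<in> I" "R i j" for i j
  proof (rule ccontr)
    assume neq: "j \<noteq> f i"
    have "f ` I = I" using endo_inj_surj[OF fin] inj[OF f] f by blast
    with j(1) have "j \<in> f ` I" by simp
    then obtain l where l: "l \<in> I" "f l = j" by auto
    have "inj_on (f(i := j)) I" by (rule inj) (simp add: f j)
    moreover have "(f(i := j)) l = (f(i := j)) i" using l by simp
    ultimately have "l = i" using l(1) i by (rule inj_onD)
    with l neq show False by simp
  qed
  then have "\<forall>i\<in>I. \<exists>!j. j \<in> I \<and> R i j" using f by metis
  with I show ?thesis by (intro exI[of _ I]) (simp add: sinkless_def)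
qed

section \<open>The correspondence\<close>

text \<open>Removes the coordinate choices \<open>k\<close>: what remains concerns only the diagonal
  and the zero pattern off it, from which a digraph can be read off.\<close>

lemma vector_matrices_iff:
  assumes \<omega>: "\<forall>i<n. \<omega> i \<ge> 1"
  shows "A \<in> vector_matrices \<omega> n \<longleftrightarrow>
    A \<in> carrier_mat n n \<and> (\<forall>i<n. \<forall>j<n. A $$ (i, j) \<in> carrier_vec (\<omega> i)) \<and>
    (\<forall>i<n. A $$ (i, i) = vec (\<omega> i) (\<lambda>_. 1)) \<and>
    (\<forall>S\<subseteq>{..<n}. S \<noteq> {} \<longrightarrow> (\<exists>i\<in>S. \<forall>j\<in>S. j \<noteq> i \<longrightarrow> A $$ (i, j) = 0\<^sub>v (\<omega> i)))"
proof -
  have coord: "coordinate_matrix n A k \<in> carrier_mat n n" for k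
    by (simp add: coordinate_matrix_def)
  have sum_coord: "(\<Sum>j\<in>S. coordinate_matrix n A k $$ (i, j)) = (\<Sum>j\<in>S. A $$ (i, j) $ k i)"
    if "S \<subseteq> {..<n}" "i \<in> S" for S i k
    using that by (intro sum.cong) (auto simp: coordinate_matrix_def subset_iff)
  have minors: "(\<forall>m\<in>principal_minors (coordinate_matrix n A k). m = 1) \<longleftrightarrow>
      (\<forall>S\<subseteq>{..<n}. S \<noteq> {} \<longrightarrow> (\<exists>i\<in>S. (\<Sum>j\<in>S. A $$ (i, j) $ k i) = 1))" for k
    unfolding principal_minors_bit_eq_1_iff[OF coord]
    by (intro all_cong imp_cong refl bex_cong) (simp add: sum_coord)
  define well_dim where "well_dim \<longleftrightarrow> (\<forall>i<n. \<forall>j<n. A $$ (i, j) \<in> carrier_vec (\<omega> i))"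
  define unit_diag where "unit_diag \<longleftrightarrow> (\<forall>i<n. A $$ (i, i) = vec (\<omega> i) (\<lambda>_. 1))"
  define all_sinks where "all_sinks \<longleftrightarrow> (\<forall>S\<subseteq>{..<n}. S \<noteq> {} \<longrightarrow>
    (\<exists>i\<in>S. \<forall>j\<in>S. j \<noteq> i \<longrightarrow> A $$ (i, j) = 0\<^sub>v (\<omega> i)))"
  define odd_sums where "odd_sums \<longleftrightarrow> (\<forall>k. (\<forall>i<n. k i < \<omega> i) \<longrightarrow>
    (\<forall>S\<subseteq>{..<n}. S \<noteq> {} \<longrightarrow> (\<exists>i\<in>S. (\<Sum>j\<in>S. A $$ (i, j) $ k i) = 1)))"
  have key: "unit_diag \<and> all_sinks \<longleftrightarrow> odd_sums" if well_dim
  proof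
    assume "unit_diag \<and> all_sinks"
    then have unit_diag all_sinks by auto
    show odd_sums
      unfolding odd_sums_def
    proof (intro allI impI)
      fix k S assume k: "\<forall>i<n. k i < \<omega> i" and S: "S \<subseteq> {..<n}" "S \<noteq> {}"
      obtain i where i: "i \<in> S" and zero: "\<And>j. j \<in> S \<Longrightarrow> j \<noteq> i \<Longrightarrow> A $$ (i, j) = 0\<^sub>v (\<omega> i)"
        using \<open>all_sinks\<close> S unfolding all_sinks_def by metis
      \<comment> \<open>In the row of the sink \<open>i\<close> only the diagonal term
        survives.\<close>
      have "(\<Sum>j\<in>S. A $$ (i, j) $ k i) = (\<Sum>j\<in>{i}. A $$ (i, j) $ k i)"
        using S(1) i k zero by (intro sum.mono_neutral_right) (auto intro: finite_subset)
      also have "\<dots> = 1" using \<open>unit_diag\<close> k S(1) i by (auto simp: unit_diag_def)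
      finally show "\<exists>i\<in>S. (\<Sum>j\<in>S. A $$ (i, j) $ k i) = 1" using i by blast
    qed
  next
    assume odd_sums
    have diagonal: "A $$ (i, i) $ c = 1" if "i < n" "c < \<omega> i" for i c
    proof -
      \<comment> \<open>The set \<open>{i}\<close> isolates the diagonal entry. Row \<open>i\<close>
        is read at coordinate \<open>c\<close>, all other rows at coordinate 0, which exists because
        \<omega> is positive.\<close>
      have "\<forall>i'<n. ((\<lambda>_. 0)(i := c)) i' < \<omega> i'" using that \<omega> by (auto simp: Suc_le_eq)
      from \<open>odd_sums\<close>[unfolded odd_sums_def, rule_format, OF this[rule_format], of "{i}"]
      show ?thesis using that by simp
    qed
    then have unit_diag
      using \<open>well_dim\<close> by (auto simp: unit_diag_def well_dim_def vec_eq_iff)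
    moreover have all_sinks
      unfolding all_sinks_def
    proof (intro allI impI, rule ccontr)
      fix S assume S: "S \<subseteq> {..<n}" "S \<noteq> {}"
        and no_sink: "\<not> (\<exists>i\<in>S. \<forall>j\<in>S. j \<noteq> i \<longrightarrow> A $$ (i, j) = 0\<^sub>v (\<omega> i))"
      define R where "R i j \<longleftrightarrow> j \<noteq> i \<and> A $$ (i, j) \<noteq> 0\<^sub>v (\<omega> i)" for i j
      have "finite S" using S(1) finite_subset by blast
      moreover have "\<exists>j\<in>S. R i j" if "i \<in> S" for i
        using no_sink that by (auto simp: R_def)
      ultimately obtain I where I: "I \<subseteq> S" "I \<noteq> {}" "\<forall>i\<in>I. \<exists>!j. j \<in> I \<and> R i j"
        using sinkless_imp_unique_successors[of S R] S(2) by auto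
      have "\<exists>f. \<forall>i\<in>I. f i \<in> I \<and> R i (f i) \<and> (\<forall>j\<in>I. R i j \<longrightarrow> j = f i)"
        using I(3) by (intro bchoice) blast
      then obtain f where f: "\<And>i. i \<in> I \<Longrightarrow> f i \<in> I" "\<And>i. i \<in> I \<Longrightarrow> R i (f i)"
          "\<And>i j. i \<in> I \<Longrightarrow> j \<in> I \<Longrightarrow> R i j \<Longrightarrow> j = f i"
        by blast
      have In: "I \<subseteq> {..<n}" using I(1) S(1) by blast
      then have fin: "finite I" using finite_subset by blast
      \<comment> \<open>A non-zero vector over \<open>bit\<close> has a coordinate equal to 1. In
        rows outside \<open>I\<close> any coordinate serves, and one exists because \<omega> is
        positive.\<close>
      have "\<exists>c<\<omega> i. i \<in> I \<longrightarrow> A $$ (i, f i) $ c = 1" if "i < n" for i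
      proof (cases "i \<in> I")
        case True
        with f In have "f i < n" by blast
        then have "A $$ (i, f i) \<in> carrier_vec (\<omega> i)"
          using \<open>well_dim\<close> that by (simp add: well_dim_def)
        then show ?thesis
          using f(2)[OF True] by (auto simp: R_def vec_eq_iff)
      next
        case False
        then show ?thesis using \<omega> that by (auto simp: Suc_le_eq)
      qed
      then obtain k where k: "\<And>i. i < n \<Longrightarrow> k i < \<omega> i \<and> (i \<in> I \<longrightarrow> A $$ (i, f i) $ k i = 1)"
        by metis
      \<comment> \<open>Within \<open>I\<close> only the diagonal and the unique successor
        \<open>f i\<close> contribute to row \<open>i\<close>; both contribute 1, and
        \<open>1 + 1 = 0\<close>.\<close>
      have "(\<Sum>j\<in>I. A $$ (i, j) $ k i) = 0" if i: "i \<in> I" for i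
      proof -
        have "A $$ (i, j) $ k i = 0" if "j \<in> I - {i, f i}" for j
        proof -
          have "\<not> R i j" using f(3)[OF i, of j] that by auto
          then have "A $$ (i, j) = 0\<^sub>v (\<omega> i)" using that by (simp add: R_def)
          then show ?thesis using k[of i] i In by auto
        qed
        then have "(\<Sum>j\<in>I. A $$ (i, j) $ k i) = (\<Sum>j\<in>{i, f i}. A $$ (i, j) $ k i)"
          using fin i f(1) by (intro sum.mono_neutral_right) auto
        also have "\<dots> = A $$ (i, i) $ k i + A $$ (i, f i) $ k i"
          using f(2)[OF i] by (auto simp: R_def simp del: add_bit_eq_xor)
        also have "\<dots> = 1 + 1" using k[of i] diagonal[of i "k i"] i In by (auto simp: subset_iff)
        finally show ?thesis by simp
      qed
      moreover have "\<exists>i\<in>I. (\<Sum>j\<in>I. A $$ (i, j) $ k i) = 1"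
        using \<open>odd_sums\<close> k In I(2) by (auto simp: odd_sums_def)
      ultimately show False by auto
    qed
    ultimately show "unit_diag \<and> all_sinks" ..
  qed
  have "A \<in> vector_matrices \<omega> n \<longleftrightarrow> A \<in> carrier_mat n n \<and> well_dim \<and> odd_sums"
    by (simp add: vector_matrices_def minors well_dim_def odd_sums_def)
  also have "\<dots> \<longleftrightarrow> A \<in> carrier_mat n n \<and> well_dim \<and> unit_diag \<and> all_sinks"
    using key by blast
  finally show ?thesis
    unfolding well_dim_def unit_diag_def all_sinks_def .
qed

text \<open>The diagonal records no arcs: it holds the all-ones vectors that the one-element
  principal minors force.\<close>

definition digraph_matrix ::
    "(nat \<Rightarrow> nat) \<Rightarrow> nat \<Rightarrow> nat pair_pre_digraph \<times> (nat \<times> nat \<Rightarrow> bit vec) \<Rightarrow> bit vec mat" where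
  "digraph_matrix \<omega> n = (\<lambda>(G, w). mat n n (\<lambda>(i, j).
     if i = j then vec (\<omega> i) (\<lambda>_. 1)
     else if (i, j) \<in> parcs G then w (i, j) else 0\<^sub>v (\<omega> i)))"

definition matrix_arcs :: "(nat \<Rightarrow> nat) \<Rightarrow> nat \<Rightarrow> bit vec mat \<Rightarrow> (nat \<times> nat) set" where
  "matrix_arcs \<omega> n A = {(i, j). i < n \<and> j < n \<and> i \<noteq> j \<and> A $$ (i, j) \<noteq> 0\<^sub>v (\<omega> i)}"

text \<open>Restricting the entries to the arcs makes the weighting extensional, as membership in
  \<open>vector_weightings\<close> demands.\<close>

definition matrix_digraph ::
    "(nat \<Rightarrow> nat) \<Rightarrow> nat \<Rightarrow> bit vec mat \<Rightarrow> nat pair_pre_digraph \<times> (nat \<times> nat \<Rightarrow> bit vec)" where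
  "matrix_digraph \<omega> n A =
     (\<lparr>pverts = {..<n}, parcs = matrix_arcs \<omega> n A\<rparr>, restrict (($$) A) (matrix_arcs \<omega> n A))"

text \<open>Over a fixed finite vertex set, being a finite digraph only means that arcs join
  vertices. The sink condition then has the same shape as in
  \<open>vector_matrices_iff\<close>.\<close>

lemma acyclic_digraphs_iff:
  "G \<in> acyclic_digraphs n \<longleftrightarrow> pverts G = {..<n} \<and> parcs G \<subseteq> {..<n} \<times> {..<n} \<and>
    (\<forall>S\<subseteq>{..<n}. S \<noteq> {} \<longrightarrow> (\<exists>i\<in>S. \<forall>j\<in>S. (i, j) \<notin> parcs G))"
proof (cases "pverts G = {..<n}")
  case True
  have "pair_fin_digraph G \<longleftrightarrow> parcs G \<subseteq> {..<n} \<times> {..<n}"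
  proof
    assume "pair_fin_digraph G"
    then interpret pair_fin_digraph G .
    show "parcs G \<subseteq> {..<n} \<times> {..<n}"
      using arc_fst_in_verts arc_snd_in_verts True by force
  next
    assume arcs: "parcs G \<subseteq> {..<n} \<times> {..<n}"
    moreover have "finite (parcs G)" using arcs by (rule finite_subset) simp
    ultimately show "pair_fin_digraph G"
      by unfold_locales (auto simp: True)
  qed
  then show ?thesis
    using True acyclic_digraph_iff_sinks[of G]
    by (auto simp: acyclic_digraphs_def acyclic_digraph_def)
qed (simp add: acyclic_digraphs_def)

text \<open>The set \<open>{i}\<close> must have a sink, which can only be \<open>i\<close> itself.
  Hence overwriting the diagonal in \<open>digraph_matrix\<close> loses no arc.\<close>

lemma acyclic_digraphs_no_loop:
  assumes "G \<in> acyclic_digraphs n"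
  shows "(i, i) \<notin> parcs G"
proof
  assume "(i, i) \<in> parcs G"
  with assms have "{i} \<subseteq> {..<n}" by (auto simp: acyclic_digraphs_iff)
  with assms have "(i, i) \<notin> parcs G" unfolding acyclic_digraphs_iff by blast
  with \<open>(i, i) \<in> parcs G\<close> show False by contradiction
qed

text \<open>Weights are non-zero, so the arcs are recovered as the non-zero off-diagonal entries,
  while the diagonal is fixed on the matrix side. The sink conditions on both sides then
  coincide.\<close>

lemma bij_betw_digraph_matrix:
  assumes \<omega>: "\<forall>i<n. \<omega> i \<ge> 1"
  shows "bij_betw (digraph_matrix \<omega> n) (acyclic_weighted_digraphs \<omega> n) (vector_matrices \<omega> n)"
proof (rule bij_betw_byWitness[where f' = "matrix_digraph \<omega> n"])
  have weight: "w e \<in> carrier_vec (\<omega> (fst e))" "w e \<noteq> 0\<^sub>v (\<omega> (fst e))"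
    if "w \<in> vector_weightings \<omega> G" "e \<in> parcs G" for G w e
    using PiE_mem[OF that[unfolded vector_weightings_def]] by auto
  show "\<forall>D\<in>acyclic_weighted_digraphs \<omega> n. matrix_digraph \<omega> n (digraph_matrix \<omega> n D) = D"
  proof
    fix D assume "D \<in> acyclic_weighted_digraphs \<omega> n"
    then obtain G w where D: "D = (G, w)" and G: "G \<in> acyclic_digraphs n"
        and w: "w \<in> vector_weightings \<omega> G"
      by (auto simp: acyclic_weighted_digraphs_def)
    have sub: "parcs G \<subseteq> {..<n} \<times> {..<n}" using G by (simp add: acyclic_digraphs_iff)
    have arcs: "matrix_arcs \<omega> n (digraph_matrix \<omega> n D) = parcs G"
    proof (rule Set.set_eqI)
      fix e
      show "e \<in> matrix_arcs \<omega> n (digraph_matrix \<omega> n D) \<longleftrightarrow> e \<in> parcs G"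
        using sub acyclic_digraphs_no_loop[OF G, of "fst e"] weight(2)[OF w, of e]
        by (cases e) (auto simp: matrix_arcs_def digraph_matrix_def D subset_iff split: if_splits)
    qed
    moreover have "restrict (($$) (digraph_matrix \<omega> n D)) (parcs G) = w"
    proof
      fix e show "restrict (($$) (digraph_matrix \<omega> n D)) (parcs G) e = w e"
      proof (cases "e \<in> parcs G")
        case True
        then show ?thesis
          using sub acyclic_digraphs_no_loop[OF G]
          by (cases e) (auto simp: digraph_matrix_def D subset_iff)
      next
        case False
        \<comment> \<open>Off the arc set both functions are \<open>undefined\<close>.\<close>
        then show ?thesis
          using PiE_arb[OF w[unfolded vector_weightings_def] False] by simp
      qed
    qed
    moreover have "\<lparr>pverts = {..<n}, parcs = parcs G\<rparr> = G"
      using G by (cases G) (simp add: acyclic_digraphs_def)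
    ultimately show "matrix_digraph \<omega> n (digraph_matrix \<omega> n D) = D"
      by (simp add: matrix_digraph_def D)
  qed
  show "\<forall>A\<in>vector_matrices \<omega> n. digraph_matrix \<omega> n (matrix_digraph \<omega> n A) = A"
  proof
    fix A assume "A \<in> vector_matrices \<omega> n"
    then show "digraph_matrix \<omega> n (matrix_digraph \<omega> n A) = A"
      unfolding vector_matrices_iff[OF \<omega>]
      by (intro eq_matI) (auto simp: digraph_matrix_def matrix_digraph_def matrix_arcs_def)
  qed
  show "digraph_matrix \<omega> n ` acyclic_weighted_digraphs \<omega> n \<subseteq> vector_matrices \<omega> n"
  proof (rule image_subsetI)
    fix D assume "D \<in> acyclic_weighted_digraphs \<omega> n"
    then obtain G w where D: "D = (G, w)" and G: "G \<in> acyclic_digraphs n"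
        and w: "w \<in> vector_weightings \<omega> G"
      by (auto simp: acyclic_weighted_digraphs_def)
    have "\<forall>S\<subseteq>{..<n}. S \<noteq> {} \<longrightarrow>
        (\<exists>i\<in>S. \<forall>j\<in>S. j \<noteq> i \<longrightarrow> digraph_matrix \<omega> n D $$ (i, j) = 0\<^sub>v (\<omega> i))"
    proof (intro allI impI)
      fix S assume S: "S \<subseteq> {..<n}" "S \<noteq> {}"
      obtain i where "i \<in> S" "\<forall>j\<in>S. (i, j) \<notin> parcs G"
        using G S unfolding acyclic_digraphs_iff by metis
      then show "\<exists>i\<in>S. \<forall>j\<in>S. j \<noteq> i \<longrightarrow> digraph_matrix \<omega> n D $$ (i, j) = 0\<^sub>v (\<omega> i)"
        using S(1) by (intro bexI[of _ i]) (auto simp: digraph_matrix_def D subset_iff)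
    qed
    moreover have "\<forall>i<n. \<forall>j<n. digraph_matrix \<omega> n D $$ (i, j) \<in> carrier_vec (\<omega> i)"
      by (auto simp: digraph_matrix_def D dest: weight(1)[OF w])
    moreover have "digraph_matrix \<omega> n D \<in> carrier_mat n n"
        "\<forall>i<n. digraph_matrix \<omega> n D $$ (i, i) = vec (\<omega> i) (\<lambda>_. 1)"
      by (simp_all add: digraph_matrix_def D)
    ultimately show "digraph_matrix \<omega> n D \<in> vector_matrices \<omega> n"
      unfolding vector_matrices_iff[OF \<omega>] by (intro conjI)
  qed
  show "matrix_digraph \<omega> n ` vector_matrices \<omega> n \<subseteq> acyclic_weighted_digraphs \<omega> n"
  proof (rule image_subsetI)
    fix A assume "A \<in> vector_matrices \<omega> n"
    then have A: "\<forall>i<n. \<forall>j<n. A $$ (i, j) \<in> carrier_vec (\<omega> i)"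
      and sinks: "\<forall>S\<subseteq>{..<n}. S \<noteq> {} \<longrightarrow>
        (\<exists>i\<in>S. \<forall>j\<in>S. j \<noteq> i \<longrightarrow> A $$ (i, j) = 0\<^sub>v (\<omega> i))"
      unfolding vector_matrices_iff[OF \<omega>] by blast+
    have "\<lparr>pverts = {..<n}, parcs = matrix_arcs \<omega> n A\<rparr> \<in> acyclic_digraphs n"
      unfolding acyclic_digraphs_iff
    proof (intro conjI allI impI)
      fix S assume "S \<subseteq> {..<n}" "S \<noteq> {}"
      then obtain i where "i \<in> S" "\<forall>j\<in>S. j \<noteq> i \<longrightarrow> A $$ (i, j) = 0\<^sub>v (\<omega> i)"
        using sinks by metis
      then show "\<exists>i\<in>S. \<forall>j\<in>S. (i, j) \<notin> parcs \<lparr>pverts = {..<n}, parcs = matrix_arcs \<omega> n A\<rparr>"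
        by (intro bexI[of _ i]) (auto simp: matrix_arcs_def)
    qed (auto simp: matrix_arcs_def)
    moreover have "restrict (($$) A) (matrix_arcs \<omega> n A)
        \<in> vector_weightings \<omega> \<lparr>pverts = {..<n}, parcs = matrix_arcs \<omega> n A\<rparr>"
      using A by (auto simp: vector_weightings_def matrix_arcs_def)
    ultimately show "matrix_digraph \<omega> n A \<in> acyclic_weighted_digraphs \<omega> n"
      by (simp add: acyclic_weighted_digraphs_def matrix_digraph_def)
  qed
qed

section \<open>Counting\<close>

text \<open>Reading off coordinates identifies vectors of dimension \<open>m\<close> with
  extensional functions on \<open>{..<m}\<close>.\<close>

lemma card_carrier_vec_eq_power:
  "card (carrier_vec m :: 'a vec set) = card (UNIV :: 'a set) ^ m"
proof -
  have "bij_betw (vec m) ({..<m} \<rightarrow>\<^sub>E (UNIV :: 'a set)) (carrier_vec m)"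
    by (rule bij_betw_byWitness[where f' = "\<lambda>v. restrict (($) v) {..<m}"])
       (auto simp: vec_eq_iff PiE_def extensional_def fun_eq_iff)
  from bij_betw_same_card[OF this] show ?thesis
    by (simp add: card_PiE)
qed

lemma card_carrier_vec_bit: "card (carrier_vec m :: bit vec set) = 2 ^ m"
proof -
  have "(UNIV :: bit set) = {0, 1}"
    by (metis (full_types) UNIV_eq_I bit_not_zero_iff insertI1 insertI2)
  then have "card (UNIV :: bit set) = card {0 :: bit, 1}"
    by (rule arg_cong)
  also have "\<dots> = 2" by simp
  finally show ?thesis
    by (simp only: card_carrier_vec_eq_power)
qed

lemma finite_vector_weightings:
  assumes "finite (parcs G)"
  shows "finite (vector_weightings \<omega> G)"
proof -
  have "finite (carrier_vec m :: bit vec set)" for m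
    \<comment> \<open>Infinite sets have \<open>card\<close> 0, so the positive value
      \<open>2 ^ m\<close> proves finiteness.\<close>
    by (rule card_ge_0_finite) (simp add: card_carrier_vec_bit)
  with assms show ?thesis
    unfolding vector_weightings_def by (intro finite_PiE) auto
qed

text \<open>Arcs are weighted independently, with \<open>2 ^ \<omega> v - 1\<close> choices for an
  arc with tail \<open>v\<close>; grouping the arcs by tail turns these factors into powers. The
  subtraction on naturals never truncates.\<close>

lemma card_vector_weightings:
  assumes "pair_fin_digraph G"
  shows "card (vector_weightings \<omega> G) =
    (\<Prod>v\<in>pverts G. (2 ^ \<omega> v - 1) ^ out_degree (with_proj G) v)"
proof -
  interpret pair_fin_digraph G by fact
  have "card (vector_weightings \<omega> G) = (\<Prod>e\<in>parcs G. 2 ^ \<omega> (fst e) - 1)"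
    using pair_finite_arcs
    by (simp add: vector_weightings_def card_PiE card_Diff_singleton card_carrier_vec_bit)
  also have "\<dots> = (\<Prod>v\<in>pverts G. \<Prod>e\<in>{e\<in>parcs G. fst e = v}. 2 ^ \<omega> (fst e) - 1)"
    using pair_finite_arcs pair_finite_verts
    by (intro prod.group[symmetric]) (auto dest: in_arcsD1)
  also have "\<dots> = (\<Prod>v\<in>pverts G. (2 ^ \<omega> v - 1) ^ out_degree (with_proj G) v)"
    by (simp add: out_degree_def out_arcs_def)
  finally show ?thesis .
qed

text \<open>Once the vertex set is fixed, a digraph is determined by its arc set.\<close>

lemma finite_acyclic_digraphs: "finite (acyclic_digraphs n)"
proof (rule finite_subset)
  show "acyclic_digraphs n \<subseteq>
      (\<lambda>E. \<lparr>pverts = {..<n}, parcs = E\<rparr>) ` Pow ({..<n} \<times> {..<n})"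
  proof
    fix G assume "G \<in> acyclic_digraphs n"
    then show "G \<in> (\<lambda>E. \<lparr>pverts = {..<n}, parcs = E\<rparr>) ` Pow ({..<n} \<times> {..<n})"
      by (intro image_eqI[of _ _ "parcs G"]) (auto simp: acyclic_digraphs_iff)
  qed
qed simp

theorem proposition3p2:
  fixes n :: nat and \<omega> :: "nat \<Rightarrow> nat"
  assumes "\<And>i. i < n \<Longrightarrow> \<omega> i \<ge> 1"
  shows "(\<exists>\<phi>. bij_betw \<phi> (acyclic_weighted_digraphs \<omega> n) (vector_matrices \<omega> n)) \<and>
    card (vector_matrices \<omega> n) =
      (\<Sum>G\<in>acyclic_digraphs n. \<Prod>v\<in>pverts G. (2 ^ \<omega> v - 1) ^ out_degree (with_proj G) v)"
proof
  have bij: "bij_betw (digraph_matrix \<omega> n) (acyclic_weighted_digraphs \<omega> n) (vector_matrices \<omega> n)"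
    using assms by (intro bij_betw_digraph_matrix) blast
  then show "\<exists>\<phi>. bij_betw \<phi> (acyclic_weighted_digraphs \<omega> n) (vector_matrices \<omega> n)"
    by blast
  have fin: "pair_fin_digraph G" if "G \<in> acyclic_digraphs n" for G
    using that by (simp add: acyclic_digraphs_def acyclic_digraph_def)
  have "card (vector_matrices \<omega> n) = card (acyclic_weighted_digraphs \<omega> n)"
    using bij_betw_same_card[OF bij] by simp
  \<comment> \<open>As a dependent sum over the underlying digraphs, the set is counted fibre by
    fibre.\<close>
  also have "acyclic_weighted_digraphs \<omega> n = Sigma (acyclic_digraphs n) (vector_weightings \<omega>)"
    by (auto simp: acyclic_weighted_digraphs_def)
  also have "card \<dots> = (\<Sum>G\<in>acyclic_digraphs n. card (vector_weightings \<omega> G))"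
    using finite_acyclic_digraphs fin
    by (intro card_SigmaI) (auto intro: finite_vector_weightings pair_fin_digraph.pair_finite_arcs)
  also have "\<dots> = (\<Sum>G\<in>acyclic_digraphs n. \<Prod>v\<in>pverts G. (2 ^ \<omega> v - 1) ^ out_degree (with_proj G) v)"
    using fin by (intro sum.cong) (auto simp: card_vector_weightings)
  finally show "card (vector_matrices \<omega> n) =
      (\<Sum>G\<in>acyclic_digraphs n. \<Prod>v\<in>pverts G. (2 ^ \<omega> v - 1) ^ out_degree (with_proj G) v)" .
qed

end
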